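(* Let $P$ be a finite poset on $[d]$ which is a disjoint union of chains. Then for every edge partition $\ell$ of $P$, the order-chain polytope $\mathcal{OC}_\ell(P)$ is unimodularly equivalent to the chain polytope $\mathcal{C}(Q)$ of some poset $Q$ on $[d]$ which is a disjoint union of zigzag posets.
   Context: For a finite poset $(P,\preccurlyeq)$ on $[d]$: the order polytope $\mathcal{O}(P)$ is the set of $x\in\mathbb{R}^d$ with $0\le x_i\le 1$ for all $i$ and $x_i\ge x_j$ whenever $i\preccurlyeq j$. The chain polytope $\mathcal{C}(P)$ is the set of $x\in\mathbb{R}^d$ with $x_i\ge 0$ and $x_{i_1}+\dots+x_{i_k}\le 1$ for every maximal chain $i_1\prec\dots\prec i_k$ of $P$. An edge partition of $P$ is an ordered pair $\ell=(oE(P),cE(P))$ of disjoint sets with union $E(P)$, the edge set of the Hasse diagram of $P$; $P'_\ell$ (resp. $P''_\ell$) is the poset on $[d]$ whose Hasse diagram has edge set $oE(P)$ (resp. $cE(P)$), and $\mathcal{OC}_\ell(P)=\mathcal{O}(P'_\ell)\cap\mathcal{C}(P''_\ell)$. A zigzag poset on $[m]$ is a poset whose cover relations are exactly $1\prec\cdots\prec i_1\succ i_1+1\succ\cdots\succ i_2\prec i_2+1\prec\cdots\prec i_3\succ\cdots$, i.e. each pair $\{j,j+1\}$ ($1\le j<m$) is a cover relation in one of the two directions and there are no other cover relations. Two polytopes $\mathcal{P},\mathcal{Q}\subset\mathbb{R}^d$ are unimodularly equivalent if there is an affine map $x\mapsto Ux+b$ with $U\in GL_d(\mathbb{Z})$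 and $b\in\mathbb{Z}^d$ mapping $\mathcal{P}$ onto $\mathcal{Q}$. *)

theory Defs
  imports "HOL-Analysis.Analysis" "HOL-Library.Disjoint_Sets"
begin

text \<open>
  A poset on \<open>[d]\<close> is a reflexive partial order on a finite type \<open>'n\<close> with \<open>d\<close> elements, given as
  a set of pairs; \<open>(i, j) \<in> r\<close> means \<open>i \<preceq> j\<close>, and \<open>\<real>\<^sup>d\<close> is \<open>real ^ 'n\<close>.
\<close>

definition hasse_edges :: "'a rel \<Rightarrow> 'a rel" where
  "hasse_edges r = {(i, j). (i, j) \<in> r \<and> i \<noteq> j \<and>
     \<not> (\<exists>k. k \<noteq> i \<and> k \<noteq> j \<and> (i, k) \<in> r \<and> (k, j) \<in> r)}"

text \<open>
  The description is proper when \<open>E\<close> consists of edges of the Hasse diagram of a poset, see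
  \<open>poset_of_edges_unique\<close> and \<open>poset_of_edges_eq_rtrancl\<close> below.
\<close>
definition poset_of_edges :: "('n::finite) rel \<Rightarrow> 'n rel" where
  "poset_of_edges E = (THE r. partial_order_on UNIV r \<and> hasse_edges r = E)"

definition order_polytope :: "('n::finite) rel \<Rightarrow> (real ^ 'n) set" where
  "order_polytope r = {x. (\<forall>i. 0 \<le> x $ i \<and> x $ i \<le> 1) \<and> (\<forall>i j. (i, j) \<in> r \<longrightarrow> x $ i \<ge> x $ j)}"

definition chain_polytope :: "('n::finite) rel \<Rightarrow> (real ^ 'n) set" where
  "chain_polytope r = {x. (\<forall>i. 0 \<le> x $ i) \<and>
     (\<forall>C. pred_on.maxchain UNIV (\<lambda>i j. (i, j) \<in> r) C \<longrightarrow> (\<Sum>i\<in>C. x $ i) \<le> 1)}"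

definition edge_partition :: "('n::finite) rel \<Rightarrow> 'n rel \<times> 'n rel \<Rightarrow> bool" where
  "edge_partition r l \<longleftrightarrow> fst l \<inter> snd l = {} \<and> fst l \<union> snd l = hasse_edges r"

text \<open>The poset enters only through the edge partition, whose two parts make up its edge set.\<close>
definition order_chain_polytope :: "('n::finite) rel \<times> 'n rel \<Rightarrow> (real ^ 'n) set" where
  "order_chain_polytope l =
     order_polytope (poset_of_edges (fst l)) \<inter> chain_polytope (poset_of_edges (snd l))"

definition zigzag :: "nat \<Rightarrow> nat rel \<Rightarrow> bool" where
  "zigzag m s \<longleftrightarrow> partial_order_on {1..m} s \<and>
     (\<forall>j\<in>{1..<m}. (j, j + 1) \<in> hasse_edges s \<or> (j + 1, j) \<in> hasse_edges s) \<and>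
     (\<forall>(i, j)\<in>hasse_edges s. j = i + 1 \<or> i = j + 1)"

text \<open>A copy on \<open>A\<close> of a zigzag poset on \<open>[m]\<close>, where \<open>m = card A\<close>.\<close>
definition zigzag_on :: "'a set \<Rightarrow> 'a rel \<Rightarrow> bool" where
  "zigzag_on A r \<longleftrightarrow>
     (\<exists>m s f. zigzag m s \<and> bij_betw f {1..m} A \<and> r = map_prod f f ` s)"

text \<open>
  The poset \<open>r\<close> is the disjoint union of its restrictions to the blocks of a partition, and each of
  these restrictions is of the given kind.
\<close>
definition disjoint_union_of :: "('n set \<Rightarrow> 'n rel \<Rightarrow> bool) \<Rightarrow> ('n::finite) rel \<Rightarrow> bool" where
  "disjoint_union_of K r \<longleftrightarrow>
     (\<exists>\<A>. partition_on UNIV \<A> \<and> r = (\<Union>A\<in>\<A>. r \<inter> A \<times> A) \<and> (\<forall>A\<in>\<A>. K A (r \<inter> A \<times> A)))"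

text \<open>\<open>invertible\<close> is meant over \<open>int\<close>, so it says that \<open>U\<close> lies in \<open>GL\<^sub>d(\<int>)\<close>.\<close>
definition unimodularly_equivalent :: "(real ^ 'n) set \<Rightarrow> (real ^ ('n::finite)) set \<Rightarrow> bool" where
  "unimodularly_equivalent S T \<longleftrightarrow>
     (\<exists>(U :: int ^ 'n ^ 'n) (b :: int ^ 'n). invertible U \<and>
        (\<lambda>x. map_matrix real_of_int U *v x + (\<chi> i. real_of_int (b $ i))) ` S = T)"

lemma poset_eq_rtrancl_hasse:
  fixes r :: "('n::finite) rel"
  assumes "partial_order_on UNIV r"
  shows "r = (hasse_edges r)\<^sup>*"
proof
  have tr: "trans r" and rf: "refl r" and as: "antisym r"
    using assms by (auto simp: partial_order_on_def preorder_on_def)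
  have "(i, j) \<in> (hasse_edges r)\<^sup>*" if "(i, j) \<in> r" for i j
    using that
  proof (induction "card {k. (i, k) \<in> r \<and> (k, j) \<in> r}" arbitrary: i j rule: less_induct)
    case less
    show ?case
    proof (cases "i = j \<or> (i, j) \<in> hasse_edges r")
      case False
      then obtain k where k: "k \<noteq> i" "k \<noteq> j" "(i, k) \<in> r" "(k, j) \<in> r"
        using less.prems by (auto simp: hasse_edges_def)
      have "{l. (i, l) \<in> r \<and> (l, k) \<in> r} \<subset> {l. (i, l) \<in> r \<and> (l, j) \<in> r}"
      proof (rule psubsetI)
        show "{l. (i, l) \<in> r \<and> (l, k) \<in> r} \<subseteq> {l. (i, l) \<in> r \<and> (l, j) \<in> r}"
          using k tr by (auto dest: transD)
        have "(j, k) \<notin> r" using k as by (auto dest: antisymD)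
        moreover have "(j, j) \<in> r" using rf by (auto dest: refl_onD)
        ultimately show "{l. (i, l) \<in> r \<and> (l, k) \<in> r} \<noteq> {l. (i, l) \<in> r \<and> (l, j) \<in> r}"
          using less.prems by blast
      qed
      then have 1: "(i, k) \<in> (hasse_edges r)\<^sup>*"
        by (intro less.hyps psubset_card_mono k) auto
      have "{l. (k, l) \<in> r \<and> (l, j) \<in> r} \<subset> {l. (i, l) \<in> r \<and> (l, j) \<in> r}"
      proof (rule psubsetI)
        show "{l. (k, l) \<in> r \<and> (l, j) \<in> r} \<subseteq> {l. (i, l) \<in> r \<and> (l, j) \<in> r}"
          using k tr by (auto dest: transD)
        have "(k, i) \<notin> r" using k as by (auto dest: antisymD)
        moreover have "(i, i) \<in> r" using rf by (auto dest: refl_onD)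
        ultimately show "{l. (k, l) \<in> r \<and> (l, j) \<in> r} \<noteq> {l. (i, l) \<in> r \<and> (l, j) \<in> r}"
          using less.prems by blast
      qed
      then have 2: "(k, j) \<in> (hasse_edges r)\<^sup>*"
        by (intro less.hyps psubset_card_mono k) auto
      from 1 2 show ?thesis by simp
    qed auto
  qed
  then show "r \<subseteq> (hasse_edges r)\<^sup>*" by auto
  have "hasse_edges r \<subseteq> r" by (auto simp: hasse_edges_def)
  then have "(hasse_edges r)\<^sup>* \<subseteq> r\<^sup>*" by (rule rtrancl_mono)
  also have "\<dots> = r"
  proof (rule equalityI[OF subrelI])
    fix i j assume "(i, j) \<in> r\<^sup>*"
    then show "(i, j) \<in> r"
      by (induction rule: rtrancl_induct) (use tr rf in \<open>auto dest: refl_onD transD\<close>)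
  qed auto
  finally show "(hasse_edges r)\<^sup>* \<subseteq> r" .
qed

lemma rtrancl_subset_hasse:
  fixes r :: "('n::finite) rel"
  assumes r: "partial_order_on UNIV r" and E: "E \<subseteq> hasse_edges r"
  shows "partial_order_on UNIV (E\<^sup>*)" and "hasse_edges (E\<^sup>*) = E"
proof -
  have sub: "E\<^sup>* \<subseteq> r"
    using rtrancl_mono[OF E] poset_eq_rtrancl_hasse[OF r] by simp
  have as: "antisym r" using r by (simp add: partial_order_on_def)
  show "partial_order_on UNIV (E\<^sup>*)"
    using antisym_subset[OF sub as]
    by (simp add: partial_order_on_def preorder_on_def refl_rtrancl trans_rtrancl)
  show "hasse_edges (E\<^sup>*) = E"
  proof
    show "hasse_edges (E\<^sup>*) \<subseteq> E"
    proof (rule subrelI)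
      fix i j assume ij: "(i, j) \<in> hasse_edges (E\<^sup>*)"
      then have "(i, j) \<in> E\<^sup>*" "i \<noteq> j" by (auto simp: hasse_edges_def)
      then obtain k where k: "(i, k) \<in> E" "(k, j) \<in> E\<^sup>*"
        by (auto elim: converse_rtranclE)
      have "k \<noteq> i" using k(1) E by (auto simp: hasse_edges_def)
      then have "k = j" using ij k by (auto simp: hasse_edges_def)
      then show "(i, j) \<in> E" using k by simp
    qed
    show "E \<subseteq> hasse_edges (E\<^sup>*)"
    proof (rule subrelI)
      fix i j assume "(i, j) \<in> E"
      then show "(i, j) \<in> hasse_edges (E\<^sup>*)"
        using E sub unfolding hasse_edges_def by blast
    qed
  qed
qed

lemma poset_of_edges_unique:
  fixes r :: "('n::finite) rel"
  assumes "partial_order_on UNIV r" and "E \<subseteq> hasse_edges r"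
  shows "\<exists>!s. partial_order_on UNIV s \<and> hasse_edges s = E"
proof (rule ex1I[of _ "E\<^sup>*"])
  show "partial_order_on UNIV (E\<^sup>*) \<and> hasse_edges (E\<^sup>*) = E"
    using rtrancl_subset_hasse[OF assms] by simp
next
  fix s :: "'n rel" assume "partial_order_on UNIV s \<and> hasse_edges s = E"
  then show "s = E\<^sup>*" using poset_eq_rtrancl_hasse[of s] by simp
qed

lemma poset_of_edges_eq_rtrancl:
  fixes r :: "('n::finite) rel"
  assumes "partial_order_on UNIV r" and "E \<subseteq> hasse_edges r"
  shows "poset_of_edges E = E\<^sup>*"
  unfolding poset_of_edges_def
  using rtrancl_subset_hasse[OF assms] poset_of_edges_unique[OF assms]
  by (intro the1_equality) auto

end

(*
  Substitute y_i = x_i - x_j when i is the lower end of an o-edge (i, j), and y_i = x_i when it is not.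
  This is unipotent, with inverse x_i = sum of y_k over the o-path going up from i.  An order-chain
  constraint sum x <= 1 over a c-path a, ..., b becomes sum y <= 1 over that c-path extended by the
  o-path going up from b, and the order constraints become y >= 0.  Consecutive maximal intervals of this
  form meet exactly at the vertices entered by an o-edge and left by a c-edge, so they are the
  maximal chains of the poset obtained by reversing the direction of each chain at those vertices.
*)
theory Submission
  imports Defs
begin

section \<open>Chain constraints, and transport of posets along injections\<close>

text \<open>Every chain of a finite type extends to a maximal one, and with nonnegative coordinates
  the extension can only increase the sum. Later arguments may thus use any chain without deciding
  which ones are maximal.\<close>

lemma chain_polytope_eq_chains:
  fixes r :: "('n::finite) rel"
  shows "chain_polytope r = {x. (\<forall>i. 0 \<le> x $ i) \<and>
    (\<forall>C. pred_on.chain UNIV (\<lambda>i j. (i, j) \<in> r) C \<longrightarrow> (\<Sum>i\<in>C. x $ i) \<le> 1)}"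
proof -
  let ?chain = "pred_on.chain UNIV (\<lambda>i j. (i, j) \<in> r)"
  let ?maxchain = "pred_on.maxchain UNIV (\<lambda>i j. (i, j) \<in> r)"
  have ext: "\<exists>D. C \<subseteq> D \<and> ?maxchain D" if "?chain C" for C
    using finite_has_maximal2[of "Collect ?chain" C] that
    by (auto simp: pred_on.maxchain_def)
  have "(\<Sum>i\<in>C. x $ i) \<le> 1"
    if x: "\<And>i. 0 \<le> x $ i" "\<And>C. ?maxchain C \<Longrightarrow> (\<Sum>i\<in>C. x $ i) \<le> 1" and C: "?chain C"
    for x :: "real ^ 'n" and C
  proof -
    obtain D where "C \<subseteq> D" "?maxchain D" using ext[OF C] by blast
    then show ?thesis using x sum_mono2[of D C "($) x"] by fastforce
  qed
  then show ?thesis by (auto simp: chain_polytope_def pred_on.maxchain_def)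
qed

text \<open>Serves to carry a block of \<open>Q\<close> into the natural numbers, where
  \<open>zigzag\<close> is defined. The map will be \<open>position\<close>, which can repeat values
  across blocks, hence injectivity on \<open>A\<close> only.\<close>

lemma hasse_edges_map_prod:
  assumes "inj_on f A" "r \<subseteq> A \<times> A"
  shows "hasse_edges (map_prod f f ` r) = map_prod f f ` hasse_edges r"
proof -
  have eq: "f i = f j \<longleftrightarrow> i = j" if "i \<in> A" "j \<in> A" for i j
    using assms(1) that by (auto dest: inj_onD)
  have in_A: "i \<in> A" "j \<in> A" if "(i, j) \<in> r" for i j
    using that assms(2) by blast+
  have image: "(a, b) \<in> map_prod f f ` r \<longleftrightarrow> (\<exists>i j. a = f i \<and> b = f j \<and> (i, j) \<in> r)" for a b
    by (simp add: image_iff Bex_def) blast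
  have mem: "(f i, f j) \<in> map_prod f f ` r \<longleftrightarrow> (i, j) \<in> r" if ij: "i \<in> A" "j \<in> A" for i j
  proof
    assume "(f i, f j) \<in> map_prod f f ` r"
    then obtain i' j' where *: "f i = f i'" "f j = f j'" "(i', j') \<in> r" using image by blast
    then have "i = i'" "j = j'" using ij in_A[OF *(3)] eq by blast+
    then show "(i, j) \<in> r" using * by simp
  qed force
  have hasse: "(f i, f j) \<in> hasse_edges (map_prod f f ` r) \<longleftrightarrow> (i, j) \<in> hasse_edges r"
    if ij: "i \<in> A" "j \<in> A" for i j
  proof -
    have between: "f k \<noteq> f i \<and> f k \<noteq> f j \<and> (f i, f k) \<in> map_prod f f ` r \<and> (f k, f j) \<in> map_prod f f ` r \<longleftrightarrow>
        k \<noteq> i \<and> k \<noteq> j \<and> (i, k) \<in> r \<and> (k, j) \<in> r" if "k \<in> A" for k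
      using mem[OF ij(1) that] mem[OF that ij(2)] eq[OF that ij(1)] eq[OF that ij(2)] by simp
    have "(\<exists>c. c \<noteq> f i \<and> c \<noteq> f j \<and> (f i, c) \<in> map_prod f f ` r \<and> (c, f j) \<in> map_prod f f ` r) \<longleftrightarrow>
        (\<exists>k. k \<noteq> i \<and> k \<noteq> j \<and> (i, k) \<in> r \<and> (k, j) \<in> r)" (is "?L \<longleftrightarrow> ?R")
    proof
      assume ?L
      then obtain c where c: "c \<noteq> f i" "c \<noteq> f j" "(f i, c) \<in> map_prod f f ` r" "(c, f j) \<in> map_prod f f ` r"
        by (elim exE conjE)
      from c(3) obtain k where "c = f k" "k \<in> A" using in_A(2) by auto
      then show ?R using c between[of k] by metis
    next
      assume ?R
      then obtain k where k: "k \<noteq> i \<and> k \<noteq> j \<and> (i, k) \<in> r \<and> (k, j) \<in> r" by (elim exE)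
      then have "k \<in> A" using in_A(2) by blast
      from between[OF this] k show ?L by (intro exI[of _ "f k"]) (elim iffD2)
    qed
    then show ?thesis
      unfolding hasse_edges_def mem_Collect_eq prod.case mem[OF ij] eq[OF ij] by simp
  qed
  show ?thesis
  proof (intro equalityI subrelI)
    fix a b assume ab: "(a, b) \<in> hasse_edges (map_prod f f ` r)"
    then have "(a, b) \<in> map_prod f f ` r" by (simp add: hasse_edges_def)
    then obtain i j where "a = f i" "b = f j" "(i, j) \<in> r" using image by blast
    then have "(i, j) \<in> hasse_edges r" using ab hasse in_A by blast
    then show "(a, b) \<in> map_prod f f ` hasse_edges r"
      using \<open>a = f i\<close> \<open>b = f j\<close> by force
  next
    fix a b assume "(a, b) \<in> map_prod f f ` hasse_edges r"
    then obtain i j where ij: "a = f i" "b = f j" "(i, j) \<in> hasse_edges r" by force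
    then have "(i, j) \<in> r" by (simp add: hasse_edges_def)
    then show "(a, b) \<in> hasse_edges (map_prod f f ` r)" using ij hasse in_A by blast
  qed
qed

lemma partial_order_on_map_prod:
  assumes "inj_on f A" "partial_order_on A r"
  shows "partial_order_on (f ` A) (map_prod f f ` r)"
proof -
  have sub: "r \<subseteq> A \<times> A" and tr: "trans r" and rf: "refl_on A r" and as: "antisym r"
    using assms(2) by (auto simp: partial_order_on_def preorder_on_def)
  have eq: "f i = f j \<longleftrightarrow> i = j" if "i \<in> A" "j \<in> A" for i j
    using assms(1) that by (auto dest: inj_onD)
  have "refl_on (f ` A) (map_prod f f ` r)"
    using rf by (auto simp: refl_on_def)
  moreover have "trans (map_prod f f ` r)"
  proof (rule transI, clarsimp)
    fix a b b' c assume "(a, b) \<in> r" "(b', c) \<in> r" "f b = f b'"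
    then have "b = b'" using sub eq by auto
    then have "(a, c) \<in> r" using \<open>(a, b) \<in> r\<close> \<open>(b', c) \<in> r\<close> tr by (auto dest: transD)
    then show "(f a, f c) \<in> map_prod f f ` r" by auto
  qed
  moreover have "antisym (map_prod f f ` r)"
  proof (rule antisymI, clarsimp)
    fix a b a' b' assume "(a, b) \<in> r" "(b', a') \<in> r" "f b = f b'" "f a = f a'"
    then have "b = b'" "a = a'" using sub eq by auto
    then show "f a' = f b'" using \<open>(a, b) \<in> r\<close> \<open>(b', a') \<in> r\<close> as by (auto dest: antisymD)
  qed
  ultimately show ?thesis
    using sub by (auto simp: partial_order_on_def preorder_on_def)
qed

lemma map_matrix_of_int_mult:
  "map_matrix (of_int :: int \<Rightarrow> 'a :: comm_ring_1) (A ** B) = map_matrix of_int A ** map_matrix of_int B"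
  by (simp add: vec_eq_iff matrix_matrix_mult_def)

section \<open>Disjoint unions of chains and their Hasse edges\<close>

locale partitioned_chains =
  fixes P Eo Ec :: "('n::finite) rel"
  assumes partial_order: "partial_order_on UNIV P"
    and chains: "disjoint_union_of linear_order_on P"
    and disjoint: "Eo \<inter> Ec = {}"
    and edges: "Eo \<union> Ec = hasse_edges P"
begin

lemma P_refl [simp]: "(i, i) \<in> P"
  using partial_order by (auto simp: partial_order_on_def preorder_on_def dest: refl_onD)

lemma P_trans: "(i, j) \<in> P \<Longrightarrow> (j, k) \<in> P \<Longrightarrow> (i, k) \<in> P"
  using partial_order by (auto simp: partial_order_on_def preorder_on_def dest: transD)

lemma P_antisym: "(i, j) \<in> P \<Longrightarrow> (j, i) \<in> P \<Longrightarrow> i = j"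
  using partial_order by (auto simp: partial_order_on_def dest: antisymD)

lemma blocks:
  obtains \<A> where "partition_on UNIV \<A>"
    "\<And>i j. (i, j) \<in> P \<Longrightarrow> \<exists>A\<in>\<A>. i \<in> A \<and> j \<in> A"
    "\<And>A i j. A \<in> \<A> \<Longrightarrow> i \<in> A \<Longrightarrow> j \<in> A \<Longrightarrow> (i, j) \<in> P \<or> (j, i) \<in> P"
    "\<And>A i j. A \<in> \<A> \<Longrightarrow> (i, j) \<in> P \<Longrightarrow> i \<in> A \<longleftrightarrow> j \<in> A"
proof -
  obtain \<A> where A: "partition_on UNIV \<A>" "P = (\<Union>A\<in>\<A>. P \<inter> A \<times> A)"
      "\<And>A. A \<in> \<A> \<Longrightarrow> linear_order_on A (P \<inter> A \<times> A)"
    using chains unfolding disjoint_union_of_def by (elim exE conjE) simp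
  have block: "\<exists>A\<in>\<A>. i \<in> A \<and> j \<in> A" if "(i, j) \<in> P" for i j
    using subsetD[OF equalityD1[OF A(2)] that] by blast
  show ?thesis
  proof (rule that[OF A(1) block])
    show "i \<in> A \<longleftrightarrow> j \<in> A" if "A \<in> \<A>" "(i, j) \<in> P" for A i j
      using block[OF that(2)] that(1) disjointD[OF partition_onD2[OF A(1)]] by blast
    show "(i, j) \<in> P \<or> (j, i) \<in> P" if "A \<in> \<A>" "i \<in> A" "j \<in> A" for A i j
      using A(3)[OF that(1)] that(2,3)
      by (cases "i = j") (auto simp: linear_order_on_def total_on_def)
  qed
qed

text \<open>Comparability never leaves a block and each block is totally ordered; the dual
  \<open>above_comparable\<close> holds for the same reason.\<close>

lemma below_comparable: "(i, k) \<in> P \<Longrightarrow> (j, k) \<in> P \<Longrightarrow> (i, j) \<in> P \<or> (j, i) \<in> P"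
  by (rule blocks) metis

lemma above_comparable: "(i, j) \<in> P \<Longrightarrow> (i, k) \<in> P \<Longrightarrow> (j, k) \<in> P \<or> (k, j) \<in> P"
  by (rule blocks) metis

lemma edge_in_P: "(i, j) \<in> hasse_edges P \<Longrightarrow> (i, j) \<in> P \<and> i \<noteq> j"
  by (simp add: hasse_edges_def)

lemma Eo_edge: "(i, j) \<in> Eo \<Longrightarrow> (i, j) \<in> hasse_edges P"
  and Ec_edge: "(i, j) \<in> Ec \<Longrightarrow> (i, j) \<in> hasse_edges P"
  using edges by auto

lemma in_P_iff: "(i, j) \<in> P \<longleftrightarrow> (i, j) \<in> (hasse_edges P)\<^sup>*"
  by (rule arg_cong[OF poset_eq_rtrancl_hasse[OF partial_order]])

lemma rtrancl_in_P: "E \<subseteq> hasse_edges P \<Longrightarrow> (i, j) \<in> E\<^sup>* \<Longrightarrow> (i, j) \<in> P"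
  unfolding in_P_iff by (rule subsetD[OF rtrancl_mono])

lemma Eo_rtrancl_in_P: "(i, j) \<in> Eo\<^sup>* \<Longrightarrow> (i, j) \<in> P"
  and Ec_rtrancl_in_P: "(i, j) \<in> Ec\<^sup>* \<Longrightarrow> (i, j) \<in> P"
  using edges by (blast intro: rtrancl_in_P)+

lemma ex_edge_up:
  assumes "(i, j) \<in> P" "i \<noteq> j"
  obtains k where "(i, k) \<in> hasse_edges P" "(k, j) \<in> P"
  using assms unfolding in_P_iff by (auto elim: converse_rtranclE)

lemma edge_betweenD:
  "(i, j) \<in> hasse_edges P \<Longrightarrow> (i, k) \<in> P \<Longrightarrow> (k, j) \<in> P \<Longrightarrow> k = i \<or> k = j"
  by (auto simp: hasse_edges_def)

text \<open>Two upper neighbours of \<open>i\<close> are comparable, and the smaller would lie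
  between \<open>i\<close> and the larger. Paths going up, whether along o-edges or c-edges, are
  therefore forced.\<close>

lemma edge_up_unique: "(i, j) \<in> hasse_edges P \<Longrightarrow> (i, k) \<in> hasse_edges P \<Longrightarrow> j = k"
  using edge_in_P edge_betweenD above_comparable[of i j k] by blast

lemma edge_down_unique: "(j, i) \<in> hasse_edges P \<Longrightarrow> (k, i) \<in> hasse_edges P \<Longrightarrow> j = k"
  using edge_in_P edge_betweenD below_comparable[of j i k] by blast

section \<open>Turns and the poset \<open>Q\<close>\<close>

definition turns :: "'n set" where
  "turns = {v. \<exists>u w. (u, v) \<in> Eo \<and> (v, w) \<in> Ec}"

text \<open>The ends may be turns, because consecutive maximal chains of \<open>Q\<close> share such
  a vertex.\<close>

definition no_turn :: "'n \<Rightarrow> 'n \<Rightarrow> bool" where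
  "no_turn i j \<longleftrightarrow> (\<forall>v\<in>turns. (i, v) \<in> P \<longrightarrow> (v, j) \<in> P \<longrightarrow> v = i \<or> v = j)"

text \<open>The parity of the height is the direction in which the zigzag leaves a vertex upwards in
  \<open>P\<close>: it is reversed at every turn.\<close>
definition height :: "'n \<Rightarrow> nat" where
  "height i = card {v \<in> turns. (v, i) \<in> P}"

text \<open>The parity is read at the \<open>P\<close>-lower element of the pair: the upper one may
  be a turn, which its own height already counts.\<close>

definition Q :: "'n rel" where
  "Q = {(i, j). i = j \<or> (i, j) \<in> P \<and> no_turn i j \<and> even (height i) \<or>
                        (j, i) \<in> P \<and> no_turn j i \<and> odd (height j)}"

text \<open>Forgetting the direction removes the parity. Chains depend on comparability alone, so
  both inclusions between the polytopes see \<open>Q\<close> only in this form.\<close>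

lemma comparable_Q_iff:
  "(i, j) \<in> Q \<or> (j, i) \<in> Q \<longleftrightarrow> (i, j) \<in> P \<and> no_turn i j \<or> (j, i) \<in> P \<and> no_turn j i"
  by (auto simp: Q_def no_turn_def dest: P_antisym)

lemma no_turnD: "no_turn i j \<Longrightarrow> v \<in> turns \<Longrightarrow> (i, v) \<in> P \<Longrightarrow> (v, j) \<in> P \<Longrightarrow> v = i \<or> v = j"
  by (auto simp: no_turn_def)

text \<open>An end of the large interval that lies in the smaller one is an end of the smaller one,
  by antisymmetry.\<close>

lemma no_turn_mono: "no_turn i j \<Longrightarrow> (i, i') \<in> P \<Longrightarrow> (i', j') \<in> P \<Longrightarrow> (j', j) \<in> P \<Longrightarrow> no_turn i' j'"
  unfolding no_turn_def by (metis P_antisym P_trans)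

text \<open>A turn below \<open>j\<close> is comparable with \<open>i\<close>; if it is not below
  \<open>i\<close>, it lies in the interval, which leaves only \<open>j\<close> itself.\<close>

lemma height_step:
  assumes "(i, j) \<in> P" "i \<noteq> j" "no_turn i j"
  shows "height j = height i + of_bool (j \<in> turns)"
proof -
  have "(v, j) \<in> P \<longleftrightarrow> (v, i) \<in> P \<or> v = j" if "v \<in> turns" for v
    using that assms below_comparable no_turnD P_trans P_refl by metis
  then have "{v \<in> turns. (v, j) \<in> P} =
      {v \<in> turns. (v, i) \<in> P} \<union> (if j \<in> turns then {j} else {})"
    by auto
  moreover have "(j, i) \<notin> P" using assms P_antisym by blast
  ultimately show ?thesis by (auto simp: height_def)
qed

lemma no_turn_trans:
  assumes "(i, j) \<in> P" "(j, k) \<in> P" "no_turn i j" "no_turn j k" "j \<notin> turns"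
  shows "no_turn i k"
  unfolding no_turn_def
proof (intro ballI impI)
  fix v assume v: "v \<in> turns" "(i, v) \<in> P" "(v, k) \<in> P"
  then have "(v, j) \<in> P \<or> (j, v) \<in> P" using assms(2) below_comparable by blast
  then show "v = i \<or> v = k" using v assms no_turnD by blast
qed

lemma partial_order_Q: "partial_order_on UNIV Q"
proof -
  have "refl Q" by (auto simp: refl_on_def Q_def)
  moreover have "antisym Q"
    by (rule antisymI) (auto simp: Q_def dest: P_antisym)
  moreover have "trans Q"
  proof (rule transI)
    fix i j k assume ij: "(i, j) \<in> Q" and jk: "(j, k) \<in> Q"
    show "(i, k) \<in> Q"
    proof (cases "i = j \<or> j = k")
      case False
      then have "i \<noteq> j" "j \<noteq> k" by auto
      \<comment> \<open>The fourth combination, down and then up, would make \<open>height j\<close>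
        both odd and even.\<close>
      consider (uu) "(i, j) \<in> P" "no_turn i j" "even (height i)" "(j, k) \<in> P" "no_turn j k" "even (height j)"
        | (ud) "(i, j) \<in> P" "no_turn i j" "even (height i)" "(k, j) \<in> P" "no_turn k j" "odd (height k)"
        | (dd) "(j, i) \<in> P" "no_turn j i" "odd (height j)" "(k, j) \<in> P" "no_turn k j" "odd (height k)"
        using ij jk \<open>i \<noteq> j\<close> \<open>j \<noteq> k\<close> unfolding Q_def by blast
      then show ?thesis
      proof cases
        case uu
        \<comment> \<open>A turn at \<open>j\<close> would change the parity between
          \<open>i\<close> and \<open>j\<close>; without one the two turn-free intervals can be
          joined.\<close>
        then have "j \<notin> turns" using height_step[of i j] \<open>i \<noteq> j\<close> by auto
        then show ?thesis using uu no_turn_trans P_trans unfolding Q_def by blast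
      next
        case ud
        \<comment> \<open>Both \<open>i\<close> and \<open>k\<close> reach \<open>j\<close> from
          below without an inner turn, so their heights agree, against the parities.\<close>
        then show ?thesis
          using height_step[of i j] height_step[of k j] \<open>i \<noteq> j\<close> \<open>j \<noteq> k\<close> by auto
      next
        case dd
        then have "j \<notin> turns" using height_step[of k j] \<open>j \<noteq> k\<close> by auto
        then show ?thesis using dd no_turn_trans P_trans unfolding Q_def by blast
      qed
    qed (use ij jk in auto)
  qed
  ultimately show ?thesis by (simp add: partial_order_on_def preorder_on_def)
qed

text \<open>An inner element is no turn, so it has the height of \<open>a\<close> and both halves
  point the same way. Hence a cover in \<open>Q\<close> comes from a cover in
  \<open>P\<close>.\<close>

lemma Q_between:
  assumes "no_turn a b" "(a, k) \<in> P" "(k, b) \<in> P" "k \<noteq> a" "k \<noteq> b"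
  shows "even (height a) \<Longrightarrow> (a, k) \<in> Q \<and> (k, b) \<in> Q"
    and "odd (height a) \<Longrightarrow> (b, k) \<in> Q \<and> (k, a) \<in> Q"
proof -
  have nt: "no_turn a k" "no_turn k b"
    using assms no_turn_mono P_refl by blast+
  have "k \<notin> turns" using assms no_turnD by blast
  then have "height k = height a" using height_step[of a k] assms nt by simp
  then show "even (height a) \<Longrightarrow> (a, k) \<in> Q \<and> (k, b) \<in> Q"
    and "odd (height a) \<Longrightarrow> (b, k) \<in> Q \<and> (k, a) \<in> Q"
    using assms nt by (simp_all add: Q_def)
qed

text \<open>If \<open>k\<close> is between or outside \<open>a\<close> and \<open>b\<close> in the
  wrong order, \<open>P\<close> itself is contradicted. If \<open>k\<close> is above both or below
  both, the parities of the heights clash.\<close>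

lemma edge_no_between_Q:
  assumes "(a, b) \<in> hasse_edges P" "k \<noteq> a" "k \<noteq> b"
    and Q: "(a, k) \<in> Q \<and> (k, b) \<in> Q \<or> (b, k) \<in> Q \<and> (k, a) \<in> Q"
  shows False
proof -
  have ab: "(a, b) \<in> P" "a \<noteq> b" and nb: "\<not> ((a, k) \<in> P \<and> (k, b) \<in> P)"
    using assms(1-3) by (auto simp: hasse_edges_def)
  consider "(a, k) \<in> P" "(k, b) \<in> P" | "(k, a) \<in> P" "(b, k) \<in> P"
    | "(a, k) \<in> P" "(b, k) \<in> P" "no_turn a k" "no_turn b k" "odd (height a) \<noteq> odd (height b)"
    | "(k, a) \<in> P" "(k, b) \<in> P" "even (height k)" "odd (height k)"
    using Q assms(2,3) unfolding Q_def mem_Collect_eq prod.case by argo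
  then show False
  proof cases
    case 2
    then show ?thesis using ab P_trans P_antisym by blast
  next
    case 3
    then show ?thesis using height_step[of a k] height_step[of b k] assms(2,3) by simp
  qed (use nb in auto)
qed

text \<open>\<open>Q\<close> keeps the undirected Hasse diagram of \<open>P\<close> and changes only
  directions, which is what makes each block a zigzag.\<close>

lemma hasse_edges_Q:
  "(i, j) \<in> hasse_edges Q \<longleftrightarrow>
     (i, j) \<in> hasse_edges P \<and> even (height i) \<or> (j, i) \<in> hasse_edges P \<and> odd (height j)"
proof
  assume "(i, j) \<in> hasse_edges Q"
  then have Q: "(i, j) \<in> Q" "i \<noteq> j" and min: "\<And>k. (i, k) \<in> Q \<and> (k, j) \<in> Q \<Longrightarrow> k = i \<or> k = j"
    by (auto simp: hasse_edges_def)
  from Q consider "(i, j) \<in> P" "no_turn i j" "even (height i)"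
    | "(j, i) \<in> P" "no_turn j i" "odd (height j)"
    unfolding Q_def by auto
  then show "(i, j) \<in> hasse_edges P \<and> even (height i) \<or> (j, i) \<in> hasse_edges P \<and> odd (height j)"
  proof cases
    case 1
    have "k = i \<or> k = j" if "(i, k) \<in> P" "(k, j) \<in> P" for k
      using min Q_between(1)[OF 1(2) that] 1(3) by blast
    then have "(i, j) \<in> hasse_edges P" using 1 Q(2) by (auto simp: hasse_edges_def)
    then show ?thesis using 1 by simp
  next
    case 2
    have "k = i \<or> k = j" if "(j, k) \<in> P" "(k, i) \<in> P" for k
      using min Q_between(2)[OF 2(2) that] 2(3) by blast
    then have "(j, i) \<in> hasse_edges P" using 2 Q(2) by (auto simp: hasse_edges_def)
    then show ?thesis using 2 by simp
  qed
next
  have nt: "no_turn a b" if "(a, b) \<in> hasse_edges P" for a b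
    using edge_betweenD[OF that] by (auto simp: no_turn_def)
  assume H: "(i, j) \<in> hasse_edges P \<and> even (height i) \<or> (j, i) \<in> hasse_edges P \<and> odd (height j)"
  then have "(i, j) \<in> Q" "i \<noteq> j" using nt edge_in_P by (auto simp: Q_def)
  moreover have "\<not> (\<exists>k. k \<noteq> i \<and> k \<noteq> j \<and> (i, k) \<in> Q \<and> (k, j) \<in> Q)"
    using H edge_no_between_Q by blast
  ultimately show "(i, j) \<in> hasse_edges Q" by (simp add: hasse_edges_def)
qed

section \<open>The blocks of \<open>Q\<close> are zigzags\<close>

text \<open>The rank of \<open>i\<close> in its chain; \<open>i\<close> itself is counted, so ranks
  start at 1 as \<open>zigzag\<close> requires.\<close>

definition position :: "'n \<Rightarrow> nat" where
  "position i = card {k. (k, i) \<in> P}"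

lemma position_edge:
  assumes "(i, j) \<in> hasse_edges P"
  shows "position j = position i + 1"
proof -
  have "(k, j) \<in> P \<longleftrightarrow> k = j \<or> (k, i) \<in> P" for k
    using assms edge_in_P edge_betweenD below_comparable P_trans P_refl by metis
  then have "{k. (k, j) \<in> P} = insert j {k. (k, i) \<in> P}" by auto
  moreover have "(j, i) \<notin> P" using assms edge_in_P P_antisym by blast
  ultimately show ?thesis by (simp add: position_def)
qed

lemma position_less:
  assumes "(i, j) \<in> P" "i \<noteq> j"
  shows "position i < position j"
proof -
  have "(j, i) \<notin> P" using assms P_antisym by blast
  then have "{k. (k, i) \<in> P} \<subset> {k. (k, j) \<in> P}"
    using assms(1) P_trans P_refl by blast
  then show ?thesis by (simp add: position_def psubset_card_mono)
qed

lemma zigzag_on_Q: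
  assumes comparable: "\<And>i j. i \<in> A \<Longrightarrow> j \<in> A \<Longrightarrow> (i, j) \<in> P \<or> (j, i) \<in> P"
    and closed: "\<And>i j. (i, j) \<in> P \<Longrightarrow> i \<in> A \<longleftrightarrow> j \<in> A"
  shows "zigzag_on A (Q \<inter> A \<times> A)"
proof -
  let ?R = "Q \<inter> A \<times> A" and ?m = "card A"
  let ?s = "map_prod position position ` ?R"
  have inj: "inj_on position A"
    by (rule inj_onI) (metis comparable position_less less_irrefl)
  have "position i \<in> {1..?m}" if "i \<in> A" for i
  proof -
    have "{k. (k, i) \<in> P} \<subseteq> A" using that closed by auto
    moreover have "{k. (k, i) \<in> P} \<noteq> {}" by (auto intro: P_refl)
    ultimately show ?thesis by (auto simp: position_def card_mono Suc_le_eq card_gt_0_iff)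
  qed
  \<comment> \<open>An injective map from \<open>A\<close> into a set of the same size is
    onto.\<close>
  then have im: "position ` A = {1..?m}"
    by (intro card_subset_eq) (auto simp: card_image[OF inj])
  \<comment> \<open>Restriction creates no new covers, since anything between two elements of the
    block is in the block.\<close>
  have R: "hasse_edges ?R = hasse_edges Q \<inter> A \<times> A"
    using closed unfolding hasse_edges_def Q_def by blast
  have hasse: "hasse_edges ?s = map_prod position position ` (hasse_edges Q \<inter> A \<times> A)"
    by (simp add: hasse_edges_map_prod[OF inj] R)
  have "partial_order_on A ?R"
    using partial_order_Q
    by (auto simp: partial_order_on_def preorder_on_def refl_on_def trans_def antisym_def)
  then have "partial_order_on {1..?m} ?s"
    using partial_order_on_map_prod[OF inj] im by metis
  moreover have "(j, j + 1) \<in> hasse_edges ?s \<or> (j + 1, j) \<in> hasse_edges ?s" if "j \<in> {1..<?m}" for j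
  proof -
    have "j \<in> position ` A" "j + 1 \<in> position ` A" using that im by auto
    then obtain a b where ab: "a \<in> A" "j = position a" "b \<in> A" "j + 1 = position b" by auto
    then have "(a, b) \<in> P" "a \<noteq> b"
      using comparable[of a b] position_less[of b a] by (cases "a = b"; force)+
    \<comment> \<open>The edge going up from \<open>a\<close> ends at position \<open>j + 1\<close>,
      and injectivity identifies its end with \<open>b\<close>.\<close>
    then obtain k where k: "(a, k) \<in> hasse_edges P" by (blast elim: ex_edge_up)
    have "k \<in> A" using k edge_in_P closed ab by blast
    moreover have "position k = position b" using position_edge[OF k] ab by simp
    ultimately have "k = b" using ab inj by (auto dest: inj_onD)
    then have "(a, b) \<in> hasse_edges Q \<or> (b, a) \<in> hasse_edges Q"
      using k hasse_edges_Q by blast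
    then show ?thesis unfolding hasse using ab by force
  qed
  moreover have "j = i + 1 \<or> i = j + 1" if "(i, j) \<in> hasse_edges ?s" for i j
    using that position_edge unfolding hasse by (auto simp: hasse_edges_Q)
  ultimately have "zigzag ?m ?s" unfolding zigzag_def by blast
  moreover have "bij_betw (inv_into A position) {1..?m} A"
    using inj im by (metis bij_betw_imageI bij_betw_inv_into)
  moreover have "?R = map_prod (inv_into A position) (inv_into A position) ` ?s"
    using inj by (force simp: image_image)
  ultimately show ?thesis unfolding zigzag_on_def by blast
qed

lemma disjoint_union_of_zigzag_Q: "disjoint_union_of zigzag_on Q"
proof -
  obtain \<A> where A: "partition_on UNIV \<A>"
    "\<And>i j. (i, j) \<in> P \<Longrightarrow> \<exists>A\<in>\<A>. i \<in> A \<and> j \<in> A"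
    "\<And>A i j. A \<in> \<A> \<Longrightarrow> i \<in> A \<Longrightarrow> j \<in> A \<Longrightarrow> (i, j) \<in> P \<or> (j, i) \<in> P"
    "\<And>A i j. A \<in> \<A> \<Longrightarrow> (i, j) \<in> P \<Longrightarrow> i \<in> A \<longleftrightarrow> j \<in> A"
    by (rule blocks) (rule that; assumption)
  have "Q = (\<Union>A\<in>\<A>. Q \<inter> A \<times> A)"
  proof
    show "Q \<subseteq> (\<Union>A\<in>\<A>. Q \<inter> A \<times> A)"
    proof (rule subrelI)
      fix i j assume Q: "(i, j) \<in> Q"
      then have "(i, j) \<in> P \<or> (j, i) \<in> P" using P_refl by (auto simp: Q_def)
      then obtain A where "A \<in> \<A>" "i \<in> A" "j \<in> A" using A(2)[of i j] A(2)[of j i] by auto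
      then show "(i, j) \<in> (\<Union>A\<in>\<A>. Q \<inter> A \<times> A)" using Q by (intro UN_I) simp_all
    qed
  qed (simp add: UN_least)
  moreover have "zigzag_on A (Q \<inter> A \<times> A)" if "A \<in> \<A>" for A
    using that by (intro zigzag_on_Q A(3,4))
  ultimately show ?thesis using A(1) unfolding disjoint_union_of_def by (intro exI[of _ \<A>]) simp
qed

section \<open>The unimodular substitution and its inverse\<close>

definition U :: "int ^ 'n ^ 'n" where
  "U = (\<chi> i j. of_bool (i = j) - of_bool ((i, j) \<in> Eo))"

text \<open>The geometric series of the o-edge adjacency matrix, which inverts \<open>U\<close>; its
  entries are 0 or 1 because a path between two vertices is unique.\<close>

definition V :: "int ^ 'n ^ 'n" where
  "V = (\<chi> i j. of_bool ((i, j) \<in> Eo\<^sup>*))"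

lemma rtrancl_Image_up:
  assumes E: "E \<subseteq> hasse_edges P" and "(i, k) \<in> E"
  shows "E\<^sup>* `` {i} = insert i (E\<^sup>* `` {k})" "i \<notin> E\<^sup>* `` {k}"
proof -
  have "(i, j) \<in> E\<^sup>* \<longleftrightarrow> i = j \<or> (k, j) \<in> E\<^sup>*" for j
    using assms edge_up_unique
    by (metis converse_rtranclE converse_rtrancl_into_rtrancl rtrancl.rtrancl_refl subsetD)
  then show "E\<^sup>* `` {i} = insert i (E\<^sup>* `` {k})" by auto
  have "(i, k) \<in> P" "i \<noteq> k" using assms edge_in_P by blast+
  then show "i \<notin> E\<^sup>* `` {k}" using rtrancl_in_P[OF E, of k i] P_antisym by blast
qed

lemmas Eo_rtrancl_up = rtrancl_Image_up[OF Un_upper1[of Eo Ec, unfolded edges]]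
  and Ec_rtrancl_up = rtrancl_Image_up[OF Un_upper2[of Ec Eo, unfolded edges]]

lemma Eo_Image: "(i, k) \<in> Eo \<Longrightarrow> Eo `` {i} = {k}"
  using edge_up_unique Eo_edge by blast

lemma U_mult: "(map_matrix of_int U *v x) $ i = x $ i - (\<Sum>j\<in>Eo `` {i}. x $ j)"
  for x :: "real ^ 'n"
proof -
  have "(map_matrix of_int U *v x) $ i =
      (\<Sum>j\<in>UNIV. of_bool (i = j) * x $ j) - (\<Sum>j\<in>UNIV. of_bool ((i, j) \<in> Eo) * x $ j)"
    by (simp add: matrix_vector_mult_def U_def left_diff_distrib sum_subtractf)
  also have "(\<Sum>j\<in>UNIV. of_bool (i = j) * x $ j) = x $ i"
    by (subst sum.remove[of _ i]) auto
  also have "(\<Sum>j\<in>UNIV. of_bool ((i, j) \<in> Eo) * x $ j) = (\<Sum>j\<in>Eo `` {i}. x $ j)"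
    by (rule sum.mono_neutral_cong_right) auto
  finally show ?thesis .
qed

lemma V_mult: "(map_matrix of_int V *v x) $ i = (\<Sum>j\<in>Eo\<^sup>* `` {i}. x $ j)"
  for x :: "real ^ 'n"
  unfolding matrix_vector_mult_def V_def
  by (simp, rule sum.mono_neutral_cong_right) auto

text \<open>Row by row: for an o-edge \<open>(i, k)\<close>, the o-path from \<open>i\<close>
  exceeds the one from \<open>k\<close> by exactly \<open>i\<close>.\<close>

lemma U_V: "U ** V = mat 1"
proof -
  have "(U ** V) $ i $ j = mat 1 $ i $ j" for i j
  proof -
    have "(U ** V) $ i $ j =
        (\<Sum>k\<in>UNIV. of_bool (i = k) * V $ k $ j) - (\<Sum>k\<in>UNIV. of_bool ((i, k) \<in> Eo) * V $ k $ j)"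
      by (simp add: matrix_matrix_mult_def U_def left_diff_distrib sum_subtractf)
    also have "(\<Sum>k\<in>UNIV. of_bool (i = k) * V $ k $ j) = V $ i $ j"
      by (subst sum.remove[of _ i]) auto
    also have "(\<Sum>k\<in>UNIV. of_bool ((i, k) \<in> Eo) * V $ k $ j) = (\<Sum>k\<in>Eo `` {i}. V $ k $ j)"
      by (rule sum.mono_neutral_cong_right) auto
    also have "V $ i $ j - \<dots> = mat 1 $ i $ j"
    proof (cases "Eo `` {i} = {}")
      case True
      then have "(i, j) \<in> Eo\<^sup>* \<longleftrightarrow> i = j" by (auto elim: converse_rtranclE)
      then show ?thesis using True by (simp add: V_def mat_def)
    next
      case False
      then obtain k where k: "(i, k) \<in> Eo" by auto
      then show ?thesis
        using Eo_rtrancl_up[OF k] by (auto simp: V_def mat_def Eo_Image)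
    qed
    finally show ?thesis .
  qed
  then show ?thesis by (simp add: vec_eq_iff)
qed

text \<open>\<open>invertible\<close> asks for both products. This one goes by columns and uses the
  uniqueness of the edge entering \<open>j\<close>.\<close>

lemma V_U: "V ** U = mat 1"
proof -
  have "(V ** U) $ i $ j = mat 1 $ i $ j" for i j
  proof -
    have "(V ** U) $ i $ j =
        (\<Sum>k\<in>UNIV. V $ i $ k * of_bool (k = j)) - (\<Sum>k\<in>UNIV. V $ i $ k * of_bool ((k, j) \<in> Eo))"
      by (simp add: matrix_matrix_mult_def U_def right_diff_distrib sum_subtractf)
    also have "(\<Sum>k\<in>UNIV. V $ i $ k * of_bool (k = j)) = V $ i $ j"
      by (subst sum.remove[of _ j]) auto
    also have "(\<Sum>k\<in>UNIV. V $ i $ k * of_bool ((k, j) \<in> Eo)) = (\<Sum>k | (k, j) \<in> Eo. V $ i $ k)"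
      by (rule sum.mono_neutral_cong_right) auto
    also have "V $ i $ j - \<dots> = mat 1 $ i $ j"
    proof (cases "\<exists>k. (k, j) \<in> Eo")
      case False
      then have "(i, j) \<in> Eo\<^sup>* \<longleftrightarrow> i = j" by (auto elim: rtranclE)
      then show ?thesis using False by (simp add: V_def mat_def)
    next
      case True
      then obtain k where k: "(k, j) \<in> Eo" by auto
      have "{k. (k, j) \<in> Eo} = {k}" using k edge_down_unique Eo_edge by blast
      moreover have "(i, j) \<in> Eo\<^sup>* \<longleftrightarrow> i = j \<or> (i, k) \<in> Eo\<^sup>*"
        using k edge_down_unique Eo_edge by (metis rtrancl.simps)
      moreover have "(j, k) \<notin> Eo\<^sup>*"
        using k Eo_edge edge_in_P Eo_rtrancl_in_P P_antisym by blast
      ultimately show ?thesis by (auto simp: V_def mat_def)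
    qed
    finally show ?thesis .
  qed
  then show ?thesis by (simp add: vec_eq_iff)
qed

lemma invertible_U: "invertible U"
  using U_V V_U unfolding invertible_def by blast

lemma U_V_mult: "map_matrix of_int U *v (map_matrix of_int V *v x) = x"
  for x :: "real ^ 'n"
proof -
  have "map_matrix of_int U ** map_matrix of_int V = (mat 1 :: real ^ 'n ^ 'n)"
    unfolding map_matrix_of_int_mult[symmetric] U_V by (simp add: vec_eq_iff mat_def)
  then show ?thesis by (simp add: matrix_vector_mul_assoc)
qed

section \<open>From the order-chain polytope to the chain polytope\<close>

lemma order_chain_polytope_iff:
  "x \<in> order_chain_polytope (Eo, Ec) \<longleftrightarrow>
     (\<forall>i. 0 \<le> x $ i \<and> x $ i \<le> 1) \<and> (\<forall>i j. (i, j) \<in> Eo\<^sup>* \<longrightarrow> x $ i \<ge> x $ j) \<and>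
     (\<forall>C. pred_on.chain UNIV (\<lambda>i j. (i, j) \<in> Ec\<^sup>*) C \<longrightarrow> (\<Sum>i\<in>C. x $ i) \<le> 1)"
proof -
  have "poset_of_edges Eo = Eo\<^sup>*" "poset_of_edges Ec = Ec\<^sup>*"
    using poset_of_edges_eq_rtrancl[OF partial_order] edges by blast+
  then show ?thesis
    by (auto simp: order_chain_polytope_def order_polytope_def chain_polytope_eq_chains)
qed

text \<open>Since \<open>position\<close> is strictly monotone, comparable elements of extremal
  position are extremal in \<open>P\<close>.\<close>

lemma finite_chain_bounds:
  assumes "C \<noteq> {}" "\<And>i j. i \<in> C \<Longrightarrow> j \<in> C \<Longrightarrow> (i, j) \<in> P \<or> (j, i) \<in> P"
  obtains a b where "a \<in> C" "b \<in> C" "\<And>i. i \<in> C \<Longrightarrow> (a, i) \<in> P \<and> (i, b) \<in> P"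
proof -
  obtain a where a: "a \<in> C" "\<And>i. i \<in> C \<Longrightarrow> position a \<le> position i"
    using ex_min_if_finite[of "position ` C"] assms(1) by (auto simp: not_less)
  obtain b where b: "b \<in> C" "\<And>i. i \<in> C \<Longrightarrow> position i \<le> position b"
    using Max_in[of "position ` C"] Max_ge[of "position ` C"] assms(1) by fastforce
  show ?thesis
  proof (rule that[OF a(1) b(1)])
    fix i assume "i \<in> C"
    then show "(a, i) \<in> P \<and> (i, b) \<in> P"
      using a b assms(2)[of a i] assms(2)[of i b] position_less[of i a] position_less[of b i]
      by (metis not_le)
  qed
qed

text \<open>On an interval without interior turns all \<open>c\<close>-edges precede all \<open>o\<close>-edges, and the
  contributions of the \<open>o\<close>-edges telescope.\<close>
lemma sum_interval_le:
  fixes x :: "real ^ 'n"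
  assumes x: "x \<in> order_chain_polytope (Eo, Ec)" and "(a, b) \<in> P" "no_turn a b"
  shows "(\<Sum>i | (a, i) \<in> P \<and> (i, b) \<in> P. (map_matrix of_int U *v x) $ i) \<le> (\<Sum>i\<in>Ec\<^sup>* `` {a}. x $ i)"
proof -
  let ?y = "map_matrix of_int U *v x"
  have nonneg: "0 \<le> x $ i" for i using x by (simp add: order_chain_polytope_iff)
  have y_le: "?y $ i \<le> x $ i" for i by (simp add: U_mult sum_nonneg nonneg)
  have ge: "x $ i \<le> (\<Sum>j\<in>Ec\<^sup>* `` {i}. x $ j)" for i
    by (rule member_le_sum) (auto simp: nonneg)
  have "(a, b) \<in> (hasse_edges P)\<^sup>*"
    using assms(2) by (simp only: in_P_iff)
  then show ?thesis using \<open>no_turn a b\<close>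
  proof (induction rule: converse_rtrancl_induct)
    case base
    have "{i. (b, i) \<in> P \<and> (i, b) \<in> P} = {b}" using P_antisym by auto
    then show ?case using y_le[of b] ge[of b] by simp
  next
    case (step a c)
    have ac: "(a, c) \<in> P" "a \<noteq> c" using step.hyps edge_in_P by auto
    have cb: "(c, b) \<in> P"
      using step.hyps(2) by (simp only: in_P_iff)
    have "(a, i) \<in> P \<and> (i, b) \<in> P \<longleftrightarrow> i = a \<or> (c, i) \<in> P \<and> (i, b) \<in> P" for i
      using ac cb P_trans above_comparable edge_betweenD[OF step.hyps(1)] P_refl by metis
    then have "{i. (a, i) \<in> P \<and> (i, b) \<in> P} = insert a {i. (c, i) \<in> P \<and> (i, b) \<in> P}" by auto
    moreover have "(c, a) \<notin> P" using ac P_antisym by blast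
    ultimately have split: "(\<Sum>i | (a, i) \<in> P \<and> (i, b) \<in> P. ?y $ i) =
        ?y $ a + (\<Sum>i | (c, i) \<in> P \<and> (i, b) \<in> P. ?y $ i)"
      by simp
    have "no_turn c b" using step.prems ac cb no_turn_mono P_refl by blast
    then have IH: "(\<Sum>i | (c, i) \<in> P \<and> (i, b) \<in> P. ?y $ i) \<le> (\<Sum>i\<in>Ec\<^sup>* `` {c}. x $ i)"
      by (rule step.IH)
    show ?case
    proof (cases "(a, c) \<in> Ec")
      case True
      then show ?thesis using split IH y_le[of a] Ec_rtrancl_up[OF True] by simp
    next
      case False
      then have o: "(a, c) \<in> Eo" using step.hyps(1) edges by auto
      have y: "?y $ a = x $ a - x $ c" by (simp add: U_mult Eo_Image[OF o])
      \<comment> \<open>The induction hypothesis bounds by the whole c-path from \<open>c\<close>;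
        telescoping needs the sharper bound \<open>x $ c\<close>. If \<open>c = b\<close>, a turn is
        possible and the single term is bounded directly. Otherwise \<open>c\<close> is no turn
        although an o-edge enters it, so its c-path is trivial.\<close>
      have "(\<Sum>i | (c, i) \<in> P \<and> (i, b) \<in> P. ?y $ i) \<le> x $ c"
      proof (cases "c = b")
        case True
        have "{i. (b, i) \<in> P \<and> (i, b) \<in> P} = {b}" using P_antisym by auto
        then show ?thesis using y_le[of b] True by simp
      next
        case False
        then have "c \<notin> turns" using no_turnD[OF step.prems] ac cb by blast
        then have "Ec `` {c} = {}" using o by (auto simp: turns_def)
        then have "Ec\<^sup>* `` {c} = {c}" by (auto elim: converse_rtranclE)
        then show ?thesis using IH by simp
      qed
      then show ?thesis using split y ge[of a] by simp
    qed
  qed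
qed

text \<open>The order constraints give nonnegativity. A chain of \<open>Q\<close> can then be
  enlarged to the turn-free interval between its \<open>P\<close>-extremes, whose sum is bounded by
  that of a c-path.\<close>

lemma U_mult_in_chain_polytope:
  fixes x :: "real ^ 'n"
  assumes x: "x \<in> order_chain_polytope (Eo, Ec)"
  shows "map_matrix of_int U *v x \<in> chain_polytope Q"
proof -
  let ?y = "map_matrix of_int U *v x"
  have nonneg: "0 \<le> ?y $ i" for i
  proof (cases "Eo `` {i} = {}")
    case False
    then obtain k where k: "(i, k) \<in> Eo" by auto
    then have "x $ k \<le> x $ i" using x by (auto simp: order_chain_polytope_iff)
    then show ?thesis using Eo_Image[OF k] by (simp add: U_mult)
  qed (use x in \<open>simp add: U_mult order_chain_polytope_iff\<close>)
  have "(\<Sum>i\<in>C. ?y $ i) \<le> 1" if C: "pred_on.chain UNIV (\<lambda>i j. (i, j) \<in> Q) C" for C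
  proof (cases "C = {}")
    case False
    have comp: "(i, j) \<in> P \<and> no_turn i j \<or> (j, i) \<in> P \<and> no_turn j i" if "i \<in> C" "j \<in> C" for i j
    proof -
      have "(i, j) \<in> Q \<or> (j, i) \<in> Q"
        using C that unfolding pred_on.chain_def by (force simp: Q_def)
      then show ?thesis by (simp add: comparable_Q_iff)
    qed
    obtain a b where ab: "a \<in> C" "b \<in> C" "\<And>i. i \<in> C \<Longrightarrow> (a, i) \<in> P \<and> (i, b) \<in> P"
      using finite_chain_bounds[OF False] comp by metis
    have "(a, b) \<in> P" using ab by blast
    moreover have "no_turn a b"
      using comp[OF ab(1,2)] \<open>(a, b) \<in> P\<close> P_antisym by blast
    ultimately have "(\<Sum>i | (a, i) \<in> P \<and> (i, b) \<in> P. ?y $ i) \<le> (\<Sum>i\<in>Ec\<^sup>* `` {a}. x $ i)"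
      by (rule sum_interval_le[OF x])
    moreover have "(\<Sum>i\<in>C. ?y $ i) \<le> (\<Sum>i | (a, i) \<in> P \<and> (i, b) \<in> P. ?y $ i)"
      by (rule sum_mono2) (use ab nonneg in auto)
    \<comment> \<open>At most one c-edge leaves each vertex, so the c-path going up is a
      chain.\<close>
    moreover have "single_valued Ec"
      using edge_up_unique Ec_edge unfolding single_valued_def by blast
    then have "pred_on.chain UNIV (\<lambda>i j. (i, j) \<in> Ec\<^sup>*) (Ec\<^sup>* `` {a})"
      by (auto simp: pred_on.chain_def dest: single_valued_confluent)
    then have "(\<Sum>i\<in>Ec\<^sup>* `` {a}. x $ i) \<le> 1"
      using x by (simp add: order_chain_polytope_iff)
    ultimately show ?thesis by linarith
  qed simp
  then show ?thesis using nonneg by (simp add: chain_polytope_eq_chains)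
qed

section \<open>From the chain polytope back to the order-chain polytope\<close>

text \<open>Beyond \<open>a\<close>, the c-part consists of vertices entered by a c-edge; before
  \<open>e\<close>, the o-part consists of vertices left by an o-edge. A turn has the opposite
  edges, and edges on each side are unique.\<close>

lemma no_turn_Ec_Eo:
  assumes "(a, b) \<in> Ec\<^sup>*" "(b, e) \<in> Eo\<^sup>*"
  shows "no_turn a e"
  unfolding no_turn_def
proof (intro ballI impI)
  fix v assume v: "v \<in> turns" "(a, v) \<in> P" "(v, e) \<in> P"
  obtain u w where u: "(u, v) \<in> Eo" and w: "(v, w) \<in> Ec" using v(1) by (auto simp: turns_def)
  have c: "v = a" if "(a, b) \<in> Ec\<^sup>*" "(a, v) \<in> P" "(v, b) \<in> P" for a
    using that
  proof (induction rule: converse_rtrancl_induct)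
    case base
    then show ?case using P_antisym by blast
  next
    case (step a c)
    show ?case
    proof (rule ccontr)
      assume "v \<noteq> a"
      then have "(c, v) \<in> P"
        using step.prems step.hyps Ec_edge edge_in_P above_comparable edge_betweenD by metis
      then have "v = c" using step by blast
      \<comment> \<open>The o-edge from \<open>u\<close> and the c-edge from \<open>a\<close> enter
        the same vertex, so they would coincide.\<close>
      then have "u = a" using step.hyps(1) u Ec_edge Eo_edge edge_down_unique by blast
      then show False using u step.hyps(1) \<open>v = c\<close> disjoint by blast
    qed
  qed
  have o: "v = e" if "(b, e) \<in> Eo\<^sup>*" "(b, v) \<in> P" "(v, e) \<in> P" for e
    using that
  proof (induction rule: rtrancl_induct)
    case base
    then show ?case using P_antisym by blast
  next
    case (step c e)
    show ?case
    proof (rule ccontr)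
      assume "v \<noteq> e"
      then have "(v, c) \<in> P"
        using step.prems step.hyps Eo_edge edge_in_P below_comparable edge_betweenD by metis
      then have "v = c" using step by blast
      then have "w = e" using step.hyps(2) w Ec_edge Eo_edge edge_up_unique by blast
      then show False using w step.hyps(2) \<open>v = c\<close> disjoint by blast
    qed
  qed
  have "(v, b) \<in> P \<or> (b, v) \<in> P"
    using v assms Ec_rtrancl_in_P above_comparable by blast
  then show "v = a \<or> v = e" using c o assms v by blast
qed

text \<open>Below the top \<open>b\<close> of the chain every vertex is left by a c-edge, so
  \<open>V\<close> keeps its coordinate, while the coordinate at \<open>b\<close> expands into the
  o-path from \<open>b\<close>. Together these form a chain of \<open>Q\<close>.\<close>

lemma sum_chain_le:
  fixes y :: "real ^ 'n"
  assumes y: "y \<in> chain_polytope Q" and C: "pred_on.chain UNIV (\<lambda>i j. (i, j) \<in> Ec\<^sup>*) C"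
  shows "(\<Sum>i\<in>C. (map_matrix of_int V *v y) $ i) \<le> 1"
proof (cases "C = {}")
  case False
  let ?x = "map_matrix of_int V *v y"
  have nonneg: "0 \<le> y $ i" for i using y by (simp add: chain_polytope_def)
  have comp: "(i, j) \<in> Ec\<^sup>* \<or> (j, i) \<in> Ec\<^sup>*" if "i \<in> C" "j \<in> C" for i j
    using C that by (force simp: pred_on.chain_def)
  obtain a b where ab: "a \<in> C" "b \<in> C" "\<And>i. i \<in> C \<Longrightarrow> (a, i) \<in> P \<and> (i, b) \<in> P"
    using finite_chain_bounds[OF False] comp Ec_rtrancl_in_P by metis
  \<comment> \<open>Members of \<open>C\<close> are joined by a c-path in some direction; the
    \<open>P\<close>-bounds fix which.\<close>
  have up: "(a, i) \<in> Ec\<^sup>*" "(i, b) \<in> Ec\<^sup>*" if "i \<in> C" for i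
    using that comp ab Ec_rtrancl_in_P P_antisym by (metis rtrancl.rtrancl_refl)+
  let ?B = "C - {b}" and ?D = "Eo\<^sup>* `` {b}"
  have x_B: "?x $ i = y $ i" if "i \<in> ?B" for i
  proof -
    have "(i, b) \<in> Ec\<^sup>*" "i \<noteq> b" using up(2) that by auto
    then obtain k where "(i, k) \<in> Ec" by (auto elim: converse_rtranclE)
    then have "Eo `` {i} = {}" using Ec_edge Eo_edge edge_up_unique disjoint by blast
    then have "Eo\<^sup>* `` {i} = {i}" by (auto elim: converse_rtranclE)
    then show ?thesis by (simp add: V_mult)
  qed
  have "?B \<inter> ?D = {}"
    using ab(3) Eo_rtrancl_in_P P_antisym by blast
  have "(\<Sum>i\<in>C. ?x $ i) = ?x $ b + (\<Sum>i\<in>?B. ?x $ i)"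
    using ab(2) by (simp add: sum.remove)
  also have "\<dots> = (\<Sum>i\<in>?B. y $ i) + (\<Sum>i\<in>?D. y $ i)"
    using x_B by (simp add: V_mult)
  also have "\<dots> = (\<Sum>i\<in>?B \<union> ?D. y $ i)"
    using \<open>?B \<inter> ?D = {}\<close> by (intro sum.union_disjoint[symmetric]) auto
  also have "\<dots> \<le> 1"
  proof -
    have sv: "single_valued Eo"
      using edge_up_unique Eo_edge unfolding single_valued_def by blast
    have BB: "(i, j) \<in> Q \<or> (j, i) \<in> Q" if "i \<in> C" "j \<in> C" for i j
      using comp[OF that] Ec_rtrancl_in_P no_turn_Ec_Eo unfolding comparable_Q_iff by blast
    have BD: "(i, j) \<in> Q \<or> (j, i) \<in> Q" if "i \<in> C" "j \<in> ?D" for i j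
      using up(2)[OF that(1)] that(2) Ec_rtrancl_in_P Eo_rtrancl_in_P P_trans no_turn_Ec_Eo
      unfolding comparable_Q_iff by blast
    have DD: "(i, j) \<in> Q \<or> (j, i) \<in> Q" if "i \<in> ?D" "j \<in> ?D" for i j
    proof -
      have "(i, j) \<in> Eo\<^sup>* \<or> (j, i) \<in> Eo\<^sup>*" using single_valued_confluent[OF sv] that by blast
      then show ?thesis
        using Eo_rtrancl_in_P no_turn_Ec_Eo unfolding comparable_Q_iff by blast
    qed
    have "pred_on.chain UNIV (\<lambda>i j. (i, j) \<in> Q) (?B \<union> ?D)"
      unfolding pred_on.chain_def using BB BD DD by blast
    then show ?thesis using y by (simp add: chain_polytope_eq_chains)
  qed
  finally show ?thesis .
qed simp

lemma V_mult_in_order_chain_polytope: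
  fixes y :: "real ^ 'n"
  assumes y: "y \<in> chain_polytope Q"
  shows "map_matrix of_int V *v y \<in> order_chain_polytope (Eo, Ec)"
proof -
  have nonneg: "0 \<le> y $ i" for i using y by (simp add: chain_polytope_def)
  \<comment> \<open>The bound on a single coordinate is the constraint of a one-element
    chain.\<close>
  have "(map_matrix of_int V *v y) $ i \<le> 1" for i
    using sum_chain_le[OF y, of "{i}"] by (simp add: pred_on.chain_def)
  moreover have "(map_matrix of_int V *v y) $ j \<le> (map_matrix of_int V *v y) $ i"
    \<comment> \<open>The o-path from \<open>j\<close> is contained in the o-path from
      \<open>i\<close>.\<close>
    if "(i, j) \<in> Eo\<^sup>*" for i j
    unfolding V_mult by (rule sum_mono2) (use that nonneg in auto)
  ultimately show ?thesis
    using sum_chain_le[OF y] nonneg by (simp add: order_chain_polytope_iff V_mult sum_nonneg)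
qed

lemma unimodularly_equivalent_Q:
  "unimodularly_equivalent (order_chain_polytope (Eo, Ec)) (chain_polytope Q)"
  unfolding unimodularly_equivalent_def
proof (intro exI conjI)
  \<comment> \<open>The substitution is linear, so the translation vector is 0.\<close>
  let ?f = "\<lambda>x :: real ^ 'n. map_matrix real_of_int U *v x + (\<chi> i. real_of_int (0 $ i))"
  have f: "?f x = map_matrix real_of_int U *v x" for x
    by (simp add: vec_eq_iff)
  show "?f ` order_chain_polytope (Eo, Ec) = chain_polytope Q"
    unfolding f
  proof
    show "chain_polytope Q \<subseteq> (*v) (map_matrix of_int U) ` order_chain_polytope (Eo, Ec)"
      using V_mult_in_order_chain_polytope U_V_mult by (metis image_eqI subsetI)
  qed (use U_mult_in_chain_polytope in blast)
qed (rule invertible_U)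

end

theorem theorem3p3:
  fixes P :: "('n::finite) rel" and l :: "'n rel \<times> 'n rel"
  assumes "partial_order_on UNIV P"
    and "disjoint_union_of linear_order_on P"
    and "edge_partition P l"
  shows "\<exists>Q :: 'n rel. partial_order_on UNIV Q \<and> disjoint_union_of zigzag_on Q \<and>
           unimodularly_equivalent (order_chain_polytope l) (chain_polytope Q)"
proof -
  interpret partitioned_chains P "fst l" "snd l"
    using assms by unfold_locales (auto simp: edge_partition_def)
  show ?thesis
    using partial_order_Q disjoint_union_of_zigzag_Q unimodularly_equivalent_Q by auto
qed

end
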